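(* Let $\mathcal{X}$ be a finite set, let $\{P_\theta\mid\theta\in\Theta\}$ be a non-empty family of probability distributions on $\mathcal{X}$, let $\alpha\in[0,\infty]$, and let $Q_{\mathrm{opt}}$ be a redundancy achieving distribution. If there exists a (possibly non-unique) capacity achieving input distribution $\pi_{\mathrm{opt}}$, then the function $Q\mapsto\int D_\alpha(P_\theta\|Q)\,d\pi_{\mathrm{opt}}(\theta)$ on the probability distributions on $\mathcal{X}$ is minimized by $Q=Q_{\mathrm{opt}}$, and $D_\alpha(P_\theta\|Q_{\mathrm{opt}})=R_\alpha$ for $\pi_{\mathrm{opt}}$-almost every $\theta$.
   Context: Standing assumptions: $\Theta$ is a topological space equipped with its Borel $\sigma$-algebra, $\{\theta\}$ is a closed set for every $\theta\in\Theta$, and the map $\theta\mapsto P_\theta$ is measurable. Rényi divergence on a finite set: for $\alpha\in(0,1)\cup(1,\infty)$, $D_\alpha(P\|Q)=\frac{1}{\alpha-1}\ln\sum_x P(x)^\alpha Q(x)^{1-\alpha}\in[0,\infty]$, where for $\alpha>1$ one reads $P(x)^\alpha Q(x)^{1-\alpha}$ as $P(x)^\alpha/Q(x)^{\alpha-1}$ with the conventions $0/0=0$ and $y/0=\infty$ for $y>0$. Further $D_0(P\|Q)=\lim_{\alpha\downarrow0}D_\alpha(P\|Q)$, $D_1(P\|Q)=\lim_{\alpha\uparrow1}D_\alpha(P\|Q)$ (the Kullback-Leibler divergence) and $D_\infty(P\|Q)=\lim_{\alpha\uparrow\infty}D_\alpha(P\|Q)$ (these limits always exist in $[0,\infty]$).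 Channel capacity: $C_\alpha=\sup_\pi\inf_Q\int D_\alpha(P_\theta\|Q)\,d\pi(\theta)$; minimax redundancy: $R_\alpha=\inf_Q\sup_{\theta\in\Theta}D_\alpha(P_\theta\|Q)$, with $\pi$ ranging over probability distributions on $\Theta$ and $Q$ over probability distributions on $\mathcal{X}$. A probability distribution $\pi_{\mathrm{opt}}$ on $\Theta$ is a capacity achieving input distribution if $\inf_Q\int D_\alpha(P_\theta\|Q)\,d\pi_{\mathrm{opt}}(\theta)=C_\alpha$. A probability distribution $Q_{\mathrm{opt}}$ on $\mathcal{X}$ is a redundancy achieving distribution if $\sup_\theta D_\alpha(P_\theta\|Q_{\mathrm{opt}})=R_\alpha$ (for finite $\mathcal{X}$ such a distribution always exists). *)

theory Defs
  imports "HOL-Probability.Probability"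
begin

definition ln_ext :: "ennreal \<Rightarrow> ereal" where
  "ln_ext s = (if s = 0 then - \<infinity> else if s = \<infinity> then \<infinity> else ereal (ln (enn2real s)))"

(* For a > 1 the conventions 0/0 = 0 and y/0 = infinity (y > 0) are those of division on
   ennreal. For 0 < a < 1 both exponents are positive, so 0 powr _ = 0 is the usual value. *)
definition renyi_term :: "real \<Rightarrow> real \<Rightarrow> real \<Rightarrow> ennreal" where
  "renyi_term a p q =
     (if a < 1 then ennreal (p powr a * q powr (1 - a))
      else ennreal (p powr a) / ennreal (q powr (a - 1)))"

definition renyi_simple :: "real \<Rightarrow> 'x::finite pmf \<Rightarrow> 'x pmf \<Rightarrow> ereal" where
  "renyi_simple a P Q = ereal (1 / (a - 1)) * ln_ext (\<Sum>x\<in>UNIV. renyi_term a (pmf P x) (pmf Q x))"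

lemma Youngs_inequality_nonneg:
  fixes p q :: real
  assumes "0 < a" "a < 1" "0 \<le> p" "0 \<le> q"
  shows "p powr a * q powr (1 - a) \<le> a * p + (1 - a) * q"
  using assms Youngs_inequality_0[of a "1 - a" p q]
  by (cases "p = 0 \<or> q = 0") auto

lemma renyi_term_less_1_le:
  assumes "0 < a" "a < 1" "0 \<le> p" "0 \<le> q"
  shows "renyi_term a p q \<le> ennreal (a * p + (1 - a) * q)"
  using assms Youngs_inequality_nonneg[of a p q]
  by (simp add: renyi_term_def ennreal_leI del: ennreal_plus)

lemma renyi_term_greater_1_ge:
  assumes "1 < a" "0 \<le> p" "0 \<le> q"
  shows "ennreal (a * p) \<le> renyi_term a p q + ennreal ((a - 1) * q)"
proof (cases "q = 0")
  case True
  then show ?thesis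
    using assms by (cases "p = 0") (auto simp: renyi_term_def ennreal_divide_zero ennreal_zero_divide)
next
  case False
  then have q: "q > 0" using assms by simp
  define t where "t = p powr a / q powr (a - 1)"
  have t: "0 \<le> t" by (simp add: t_def)
  have "t powr (1 / a) * q powr ((a - 1) / a) = p"
    using assms q by (simp add: t_def powr_divide powr_powr)
  moreover have "1 - 1 / a = (a - 1) / a" using assms by (simp add: field_simps)
  with Youngs_inequality_nonneg[of "1 / a" t q]
  have "t powr (1 / a) * q powr ((a - 1) / a) \<le> 1 / a * t + (a - 1) / a * q"
    using assms t by simp
  ultimately have "p \<le> 1 / a * t + (a - 1) / a * q" by simp
  then have "a * p \<le> a * (1 / a * t + (a - 1) / a * q)"
    using assms by (intro mult_left_mono) auto
  also have "\<dots> = t + (a - 1) * q" using assms by (simp add: field_simps)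
  finally have "ennreal (a * p) \<le> ennreal (t + (a - 1) * q)" by (rule ennreal_leI)
  also have "\<dots> = ennreal t + ennreal ((a - 1) * q)"
    using assms t by (intro ennreal_plus) auto
  also have "ennreal t = renyi_term a p q"
    using assms q by (simp add: renyi_term_def t_def divide_ennreal)
  finally show ?thesis .
qed

(* Hence the truncation at 0 by e2ennreal in renyi_div below is harmless. *)
lemma renyi_simple_nonneg:
  assumes "0 < a" "a \<noteq> 1"
  shows "0 \<le> renyi_simple a P Q"
proof -
  define s where "s = (\<Sum>x\<in>UNIV. renyi_term a (pmf P x) (pmf Q x))"
  have P: "(\<Sum>x\<in>UNIV. pmf P x) = 1" and Q: "(\<Sum>x\<in>UNIV. pmf Q x) = 1"
    by (simp_all add: sum_pmf_eq_1)
  show ?thesis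
  proof (cases "a < 1")
    case True
    have "s \<le> (\<Sum>x\<in>UNIV. ennreal (a * pmf P x + (1 - a) * pmf Q x))"
      unfolding s_def using assms True by (intro sum_mono renyi_term_less_1_le) auto
    also have "\<dots> = ennreal (\<Sum>x\<in>UNIV. a * pmf P x + (1 - a) * pmf Q x)"
      using assms True by (intro sum_ennreal) auto
    also have "(\<Sum>x\<in>UNIV. a * pmf P x + (1 - a) * pmf Q x) = 1"
      using P Q by (simp add: sum.distrib flip: sum_distrib_left)
    finally have s: "s \<le> 1" by simp
    then have "enn2real s \<le> 1" using enn2real_mono[of s 1] by simp
    moreover have "s \<noteq> \<infinity>" using s by (auto simp: top_unique)
    ultimately have "ln_ext s \<le> 0"
      using s by (auto simp: ln_ext_def enn2real_positive_iff less_top zero_less_iff_neq_zero)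
    then show ?thesis
      using True unfolding renyi_simple_def s_def[symmetric]
      by (simp add: ereal_zero_le_0_iff)
  next
    case False
    then have a: "1 < a" using assms by simp
    have "ennreal a = ennreal (\<Sum>x\<in>UNIV. a * pmf P x)"
      using P by (simp flip: sum_distrib_left)
    also have "\<dots> = (\<Sum>x\<in>UNIV. ennreal (a * pmf P x))"
      using a by (intro sum_ennreal[symmetric]) auto
    also have "\<dots> \<le> (\<Sum>x\<in>UNIV. renyi_term a (pmf P x) (pmf Q x) + ennreal ((a - 1) * pmf Q x))"
      using a by (intro sum_mono renyi_term_greater_1_ge) auto
    also have "\<dots> = s + ennreal (\<Sum>x\<in>UNIV. (a - 1) * pmf Q x)"
      using a by (simp add: sum.distrib s_def sum_ennreal)
    also have "(\<Sum>x\<in>UNIV. (a - 1) * pmf Q x) = a - 1"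
      using Q by (simp flip: sum_distrib_left)
    finally have le: "ennreal a \<le> s + ennreal (a - 1)" .
    have "0 \<le> ln_ext s"
    proof (cases s)
      case (real r)
      then have "ennreal a \<le> ennreal (r + (a - 1))" using le a by (simp add: ennreal_plus)
      then have "1 \<le> r" using a real by (subst (asm) ennreal_le_iff) auto
      then show ?thesis using real by (simp add: ln_ext_def)
    next
      case top
      then show ?thesis by (simp add: ln_ext_def)
    qed
    then show ?thesis
      using a unfolding renyi_simple_def s_def[symmetric]
      by (simp add: ereal_zero_le_0_iff)
  qed
qed

definition renyi_div :: "ennreal \<Rightarrow> 'x::finite pmf \<Rightarrow> 'x pmf \<Rightarrow> ennreal" where
  "renyi_div \<alpha> P Q =
     (let D = \<lambda>a. e2ennreal (renyi_simple a P Q) in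
      if \<alpha> = 0 then Lim (at_right 0) D
      else if \<alpha> = 1 then Lim (at_left 1) D
      else if \<alpha> = \<infinity> then Lim at_top D
      else D (enn2real \<alpha>))"

definition avg_renyi_div ::
    "ennreal \<Rightarrow> ('t \<Rightarrow> 'x::finite pmf) \<Rightarrow> 't measure \<Rightarrow> 'x pmf \<Rightarrow> ennreal" where
  "avg_renyi_div \<alpha> P \<pi> Q = (\<integral>\<^sup>+ \<theta>. renyi_div \<alpha> (P \<theta>) Q \<partial>\<pi>)"

(* space (prob_algebra borel) is the set of Borel probability measures. *)
definition channel_capacity ::
    "ennreal \<Rightarrow> ('t::topological_space \<Rightarrow> 'x::finite pmf) \<Rightarrow> ennreal" where
  "channel_capacity \<alpha> P = (SUP \<pi>\<in>space (prob_algebra borel). INF Q. avg_renyi_div \<alpha> P \<pi> Q)"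

definition minimax_redundancy :: "ennreal \<Rightarrow> ('t \<Rightarrow> 'x::finite pmf) \<Rightarrow> ennreal" where
  "minimax_redundancy \<alpha> P = (INF Q. SUP \<theta>. renyi_div \<alpha> (P \<theta>) Q)"

definition capacity_achieving ::
    "ennreal \<Rightarrow> ('t::topological_space \<Rightarrow> 'x::finite pmf) \<Rightarrow> 't measure \<Rightarrow> bool" where
  "capacity_achieving \<alpha> P \<pi> \<longleftrightarrow>
     \<pi> \<in> space (prob_algebra borel) \<and> (INF Q. avg_renyi_div \<alpha> P \<pi> Q) = channel_capacity \<alpha> P"

definition redundancy_achieving ::
    "ennreal \<Rightarrow> ('t \<Rightarrow> 'x::finite pmf) \<Rightarrow> 'x pmf \<Rightarrow> bool" where
  "redundancy_achieving \<alpha> P Q \<longleftrightarrow> (SUP \<theta>. renyi_div \<alpha> (P \<theta>) Q) = minimax_redundancy \<alpha> P"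

end

theory Submission
  imports Defs
begin

text \<open>It suffices to show that the minimax redundancy \<open>R\<close> is at most the capacity: then
  \<open>R \<le> \<integral> D(P\<^sub>\<theta> \<parallel> Q\<^sub>o\<^sub>p\<^sub>t) d\<pi>\<^sub>o\<^sub>p\<^sub>t \<le> sup\<^sub>\<theta> D(P\<^sub>\<theta> \<parallel> Q\<^sub>o\<^sub>p\<^sub>t) = R < \<infinity>\<close>, which forces equality almost everywhere.
  For the minimax inequality, \<open>D(P \<parallel> Q)\<close> is convex in \<open>Q\<close>, and \<open>Q' \<le> c Q\<close> pointwise implies
  \<open>D(P \<parallel> Q) \<le> D(P \<parallel> Q') + ln c\<close>. Both properties pass from simple orders to the orders \<open>0\<close>, \<open>1\<close>, \<open>\<infinity>\<close>
  by monotonicity in the order. The second one makes \<open>D\<close> finite and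
  uniformly continuous away from the boundary of the simplex, so that by compactness finitely many
  \<open>\<theta>\<close> nearly attain the supremum for every \<open>Q\<close> there, and a minimax theorem for finitely many
  convex functions yields a finitely supported input distribution.\<close>

section \<open>Simple orders\<close>

text \<open>For \<open>a > 1\<close> a point with \<open>pmf Q x = 0\<close> contributes 0 here,
  because \<open>0 powr _ = 0\<close>. The value is therefore the intended one only under
  \<open>renyi_finite\<close>, where such points carry no mass of \<open>P\<close>.\<close>

definition renyi_sum :: "real \<Rightarrow> 'x::finite pmf \<Rightarrow> 'x pmf \<Rightarrow> real" where
  "renyi_sum a P Q = (\<Sum>x\<in>UNIV. pmf P x powr a * pmf Q x powr (1 - a))"

text \<open>Below order 1 the divergence is infinite exactly for disjoint supports, above order 1
  exactly when \<open>P\<close> is not absolutely continuous with respect to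
  \<open>Q\<close>.\<close>

definition renyi_finite :: "real \<Rightarrow> 'x::finite pmf \<Rightarrow> 'x pmf \<Rightarrow> bool" where
  "renyi_finite a P Q \<longleftrightarrow>
     (if a < 1 then 0 < renyi_sum a P Q else \<forall>x. pmf Q x = 0 \<longrightarrow> pmf P x = 0)"

definition renyi_ord :: "real \<Rightarrow> 'x::finite pmf \<Rightarrow> 'x pmf \<Rightarrow> ennreal" where
  "renyi_ord a P Q = e2ennreal (renyi_simple a P Q)"

lemma renyi_sum_nonneg: "0 \<le> renyi_sum a P Q"
  by (simp add: renyi_sum_def sum_nonneg)

lemma renyi_sum_pos_iff:
  "0 < renyi_sum a P Q \<longleftrightarrow> (\<exists>x. 0 < pmf P x \<and> 0 < pmf Q x)"
  unfolding renyi_sum_def by (subst less_le) (auto simp: sum_nonneg sum_nonneg_eq_0_iff pmf_nonneg less_le)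

lemma renyi_sum_pos:
  assumes "renyi_finite a P Q"
  shows "0 < renyi_sum a P Q"
proof (cases "a < 1")
  case True
  then show ?thesis using assms by (simp add: renyi_finite_def)
next
  case False
  obtain x where "x \<in> set_pmf P" using set_pmf_not_empty[of P] by auto
  then have "0 < pmf P x" by (simp add: pmf_positive)
  moreover have "0 < pmf Q x" 
    using assms False calculation by (auto simp: renyi_finite_def less_le)
  ultimately show ?thesis by (auto simp: renyi_sum_pos_iff)
qed

text \<open>Moves the work from extended to real arithmetic. Infinity arises in two ways: below 1
  the sum vanishes and its logarithm is multiplied by a negative factor, above 1 some summand has
  the form y/0.\<close>

lemma renyi_simple_eq:
  assumes "0 < a" "a \<noteq> 1"
  shows "renyi_simple a P Q =
    (if renyi_finite a P Q then ereal (ln (renyi_sum a P Q) / (a - 1)) else \<infinity>)"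
proof -
  define s where "s = (\<Sum>x\<in>UNIV. renyi_term a (pmf P x) (pmf Q x))"
  have r: "renyi_simple a P Q = ereal (1 / (a - 1)) * ln_ext s"
    by (simp add: renyi_simple_def s_def)
  show ?thesis
  proof (cases "a < 1 \<or> renyi_finite a P Q")
    case True
    have "renyi_term a (pmf P x) (pmf Q x) = ennreal (pmf P x powr a * pmf Q x powr (1 - a))" for x
    proof (cases "a < 1")
      case False
      then have "pmf Q x = 0 \<longrightarrow> pmf P x = 0" using True by (auto simp: renyi_finite_def)
      moreover have "pmf Q x powr (1 - a) = 1 / pmf Q x powr (a - 1)"
        using powr_minus_divide[of "pmf Q x" "a - 1"] by simp
      ultimately show ?thesis
        using False assms
        by (cases "pmf Q x = 0") (auto simp: renyi_term_def divide_ennreal less_le)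
    qed (simp add: renyi_term_def)
    then have s: "s = ennreal (renyi_sum a P Q)"
      unfolding s_def renyi_sum_def by (simp add: sum_ennreal)
    show ?thesis
    proof (cases "renyi_finite a P Q")
      case True
      then show ?thesis
        using renyi_sum_pos[OF True]
        by (simp add: r s ln_ext_def)
    next
      case False
      then have "renyi_sum a P Q = 0"  "a < 1"
        using \<open>a < 1 \<or> renyi_finite a P Q\<close> renyi_sum_nonneg[of a P Q] by (auto simp: renyi_finite_def)
      then show ?thesis using False
        by (simp add: r s ln_ext_def)
    qed
  next
    case False
    then obtain x where x: "pmf Q x = 0" "pmf P x \<noteq> 0" by (auto simp: renyi_finite_def)
    then have "renyi_term a (pmf P x) (pmf Q x) = \<infinity>"
      using False assms by (simp add: renyi_term_def ennreal_divide_zero ennreal_eq_0_iff less_le)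
    then have "s = \<infinity>" unfolding s_def
      using member_le_sum[of x UNIV "\<lambda>x. renyi_term a (pmf P x) (pmf Q x)"] by (simp add: top_unique)
    then show ?thesis using False assms
      by (auto simp: r ln_ext_def)
  qed
qed

lemma ln_renyi_sum_nonneg:
  assumes "0 < a" "a \<noteq> 1" "renyi_finite a P Q"
  shows "0 \<le> ln (renyi_sum a P Q) / (a - 1)"
  using renyi_simple_nonneg[OF assms(1,2), of P Q] assms by (simp add: renyi_simple_eq)

lemma renyi_ord_eq:
  assumes "0 < a" "a \<noteq> 1"
  shows "renyi_ord a P Q =
    (if renyi_finite a P Q then ennreal (ln (renyi_sum a P Q) / (a - 1)) else \<infinity>)"
  using assms by (simp add: renyi_ord_def renyi_simple_eq)

section \<open>Power inequalities, convexity and domination in the second argument\<close>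

text \<open>Hoelder's inequality: scale both sums to 1 and add up Young's inequality over the
  terms.\<close>

lemma holder_sum:
  fixes f g :: "'a \<Rightarrow> real"
  assumes "0 < l" "l < 1" and f: "\<And>x. x \<in> A \<Longrightarrow> 0 \<le> f x" and g: "\<And>x. x \<in> A \<Longrightarrow> 0 \<le> g x"
  shows "(\<Sum>x\<in>A. f x powr l * g x powr (1 - l)) \<le> sum f A powr l * sum g A powr (1 - l)"
proof (cases "finite A \<and> sum f A \<noteq> 0 \<and> sum g A \<noteq> 0")
  case True
  then have F: "0 < sum f A" and G: "0 < sum g A"
    using sum_nonneg[of A f] sum_nonneg[of A g] f g by (auto simp: less_le)
  have "f x powr l * g x powr (1 - l)
      \<le> (l * (f x / sum f A) + (1 - l) * (g x / sum g A)) * (sum f A powr l * sum g A powr (1 - l))"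
    if "x \<in> A" for x
  proof -
    have "(f x / sum f A) powr l * (g x / sum g A) powr (1 - l)
        \<le> l * (f x / sum f A) + (1 - l) * (g x / sum g A)"
      using assms F G that by (intro Youngs_inequality_nonneg) auto
    then show ?thesis using F G f[OF that] g[OF that] by (simp add: powr_divide field_simps)
  qed
  then have "(\<Sum>x\<in>A. f x powr l * g x powr (1 - l))
      \<le> (\<Sum>x\<in>A. (l * (f x / sum f A) + (1 - l) * (g x / sum g A)) * (sum f A powr l * sum g A powr (1 - l)))"
    by (rule sum_mono)
  also have "\<dots> = (l * (sum f A / sum f A) + (1 - l) * (sum g A / sum g A)) * (sum f A powr l * sum g A powr (1 - l))"
    by (simp only: sum.distrib sum_distrib_left[symmetric] sum_distrib_right[symmetric] sum_divide_distrib[symmetric])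
  finally show ?thesis using F G by simp
next
  \<comment> \<open>If a sum over a finite set vanishes, so do all its terms; over an infinite set
    all the sums are 0 by convention.\<close>
  case False
  then show ?thesis
    using f g by (auto simp: sum_nonneg_eq_0_iff)
qed

text \<open>Young's inequality against the mixture \<open>w\<close> acts as the tangent line at
  \<open>w\<close>. Averaging it over \<open>u\<close> and \<open>v\<close> gives \<open>w\<close>
  again, and \<open>w powr (1 - s)\<close> cancels.\<close>

lemma powr_concave_mix:
  fixes u v :: real
  assumes s: "0 < s" "s < 1" and t: "0 < t" "t < 1" and "0 \<le> u" "0 \<le> v"
  shows "(1 - t) * u powr s + t * v powr s \<le> ((1 - t) * u + t * v) powr s"
proof (cases "(1 - t) * u + t * v = 0")
  case True
  then have "(1 - t) * u = 0" "t * v = 0" using assms by (auto simp: add_nonneg_eq_0_iff)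
  then show ?thesis using t by simp
next
  case False
  define w where "w = (1 - t) * u + t * v"
  have w: "0 < w" using False assms by (auto simp: w_def less_le)
  have "(1 - t) * (u powr s * w powr (1 - s)) + t * (v powr s * w powr (1 - s))
    \<le> (1 - t) * (s * u + (1 - s) * w) + t * (s * v + (1 - s) * w)"
    using assms w by (intro add_mono mult_left_mono Youngs_inequality_nonneg) auto
  also have "\<dots> = w" by (simp add: w_def algebra_simps)
  also have "w = w powr s * w powr (1 - s)" using w by (simp flip: powr_add)
  finally have "((1 - t) * u powr s + t * v powr s) * w powr (1 - s) \<le> w powr s * w powr (1 - s)"
    by (simp add: algebra_simps)
  then show ?thesis using w unfolding w_def[symmetric] by simp
qed

text \<open>Log-convexity of a negative power: the weighted arithmetic mean dominates the geometric
  one, and the power reverses the inequality.\<close>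

lemma powr_neg_mix_le:
  fixes u v :: real
  assumes s: "0 \<le> s" and t: "0 < t" "t < 1" and "0 < u" "0 < v"
  shows "((1 - t) * u + t * v) powr - s \<le> (u powr - s) powr (1 - t) * (v powr - s) powr t"
proof -
  have "u powr (1 - t) * v powr t \<le> (1 - t) * u + t * v"
    using Youngs_inequality_nonneg[of "1 - t" u v] assms by simp
  then have "((1 - t) * u + t * v) powr - s \<le> (u powr (1 - t) * v powr t) powr - s"
    using assms by (intro powr_mono2') auto
  also have "\<dots> = (u powr - s) powr (1 - t) * (v powr - s) powr t"
    using assms by (simp add: powr_mult powr_powr mult.commute)
  finally show ?thesis .
qed

text \<open>Below order 1 the sum is concave in \<open>Q\<close>, hence so is its logarithm, and the
  factor 1 / (a - 1) is negative. Above order 1 every summand is log-convex in \<open>Q\<close>, and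
  Hoelder's inequality carries log-convexity over to the sum.\<close>

lemma renyi_ord_convex:
  assumes a: "0 < a" "a \<noteq> 1" and t: "0 < t" "t < 1"
    and mix: "\<And>x. pmf Q x = (1 - t) * pmf Q0 x + t * pmf Q1 x"
  shows "renyi_ord a P Q \<le> ennreal (1 - t) * renyi_ord a P Q0 + ennreal t * renyi_ord a P Q1"
proof (cases "renyi_finite a P Q0 \<and> renyi_finite a P Q1")
  \<comment> \<open>Both weights are positive, so an infinite divergence on the right stays infinite
    after weighting.\<close>
  case False
  then show ?thesis using a t
    by (auto simp: renyi_ord_eq ennreal_mult_top ennreal_top_mult)
next
  case True
  let ?S = "renyi_sum a P Q" and ?Sl = "renyi_sum a P Q0" and ?Sr = "renyi_sum a P Q1"
  have S0: "0 < ?Sl" and S1: "0 < ?Sr" using True renyi_sum_pos by blast+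
  have "renyi_finite a P Q \<and>
    ln ?S / (a - 1) \<le> (1 - t) * (ln ?Sl / (a - 1)) + t * (ln ?Sr / (a - 1))"
  proof (cases "a < 1")
    case True
    have "(1 - t) * ?Sl + t * ?Sr = (\<Sum>x\<in>UNIV. pmf P x powr a *
        ((1 - t) * pmf Q0 x powr (1 - a) + t * pmf Q1 x powr (1 - a)))"
      by (simp add: renyi_sum_def sum_distrib_left distrib_left sum.distrib mult.left_commute)
    also have "\<dots> \<le> ?S"
      unfolding renyi_sum_def mix
    proof (intro sum_mono mult_left_mono)
      fix x
      show "(1 - t) * pmf Q0 x powr (1 - a) + t * pmf Q1 x powr (1 - a)
          \<le> ((1 - t) * pmf Q0 x + t * pmf Q1 x) powr (1 - a)"
        using a t True by (intro powr_concave_mix) auto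
    qed simp
    finally have le: "(1 - t) * ?Sl + t * ?Sr \<le> ?S" .
    moreover have pos: "0 < (1 - t) * ?Sl + t * ?Sr" using S0 S1 t by (simp add: add_pos_pos)
    ultimately have fin: "0 < ?S" by linarith
    have "(1 - t) * ln ?Sl + t * ln ?Sr \<le> ln ((1 - t) * ?Sl + t * ?Sr)"
      using concave_onD[OF ln_concave, of t ?Sl ?Sr] S0 S1 t by simp
    also have "\<dots> \<le> ln ?S" using le pos by simp
    finally have "ln ?S / (a - 1) \<le> ((1 - t) * ln ?Sl + t * ln ?Sr) / (a - 1)"
      using True by (intro divide_right_mono_neg) auto
    then show ?thesis using fin True by (simp add: renyi_finite_def add_divide_distrib)
  next
    case False
    then have a1: "1 < a" using a by simp
    have z0: "pmf Q0 x = 0 \<Longrightarrow> pmf P x = 0" and z1: "pmf Q1 x = 0 \<Longrightarrow> pmf P x = 0" for x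
      using True False by (auto simp: renyi_finite_def)
    have fin: "renyi_finite a P Q"
    proof -
      have "pmf P x = 0" if "pmf Q x = 0" for x
      proof -
        have "(1 - t) * pmf Q0 x = 0" using that t
          by (simp add: mix add_nonneg_eq_0_iff)
        then show ?thesis using z0 t by auto
      qed
      then show ?thesis using False by (simp add: renyi_finite_def)
    qed
    \<comment> \<open>The exponent t is written as 1 - (1 - t) to fit
      \<open>holder_sum\<close>.\<close>
    have "?S \<le> (\<Sum>x\<in>UNIV. (pmf P x powr a * pmf Q0 x powr (1 - a)) powr (1 - t) *
        (pmf P x powr a * pmf Q1 x powr (1 - a)) powr (1 - (1 - t)))"
      unfolding renyi_sum_def
    proof (intro sum_mono)
      fix x
      show "pmf P x powr a * pmf Q x powr (1 - a) \<le>
        (pmf P x powr a * pmf Q0 x powr (1 - a)) powr (1 - t) *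
        (pmf P x powr a * pmf Q1 x powr (1 - a)) powr (1 - (1 - t))"
      proof (cases "pmf P x = 0")
        case False
        then have q: "0 < pmf Q0 x" "0 < pmf Q1 x" using z0 z1 by (auto simp: less_le)
        have "pmf P x powr a * pmf Q x powr (1 - a) \<le> pmf P x powr a *
            ((pmf Q0 x powr (1 - a)) powr (1 - t) * (pmf Q1 x powr (1 - a)) powr t)"
          unfolding mix using powr_neg_mix_le[of "a - 1" t "pmf Q0 x" "pmf Q1 x"] a1 t q
          by (intro mult_left_mono) auto
        also have "\<dots> = ((pmf P x powr a) powr (1 - t) * (pmf P x powr a) powr t) *
            ((pmf Q0 x powr (1 - a)) powr (1 - t) * (pmf Q1 x powr (1 - a)) powr t)"
          using False by (simp add: less_le flip: powr_add)
        finally show ?thesis by (simp add: powr_mult mult_ac)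
      qed simp
    qed
    also have "\<dots> \<le> ?Sl powr (1 - t) * ?Sr powr (1 - (1 - t))"
      unfolding renyi_sum_def using t by (intro holder_sum) auto
    finally have "ln ?S \<le> ln (?Sl powr (1 - t) * ?Sr powr t)"
      using renyi_sum_pos[OF fin] S0 S1 by (subst ln_le_cancel_iff) auto
    also have "\<dots> = (1 - t) * ln ?Sl + t * ln ?Sr"
      using S0 S1 by (simp add: ln_mult ln_powr)
    finally have "ln ?S / (a - 1) \<le> ((1 - t) * ln ?Sl + t * ln ?Sr) / (a - 1)"
      using a1 by (intro divide_right_mono) auto
    then show ?thesis using fin by (simp add: add_divide_distrib)
  qed
  then have "renyi_ord a P Q \<le> ennreal ((1 - t) * (ln ?Sl / (a - 1)) + t * (ln ?Sr / (a - 1)))"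
    using a by (simp add: renyi_ord_eq ennreal_leI del: times_divide_eq_right)
  also have "\<dots> = ennreal (1 - t) * ennreal (ln ?Sl / (a - 1)) + ennreal t * ennreal (ln ?Sr / (a - 1))"
    using True a t ln_renyi_sum_nonneg[of a P Q0] ln_renyi_sum_nonneg[of a P Q1]
    by (simp add: ennreal_plus ennreal_mult del: times_divide_eq_right)
  finally show ?thesis using True a by (simp add: renyi_ord_eq)
qed

text \<open>Replacing \<open>Q'\<close> by the larger \<open>c * Q\<close> changes the sum by a
  factor \<open>c powr (1 - a)\<close> or its inverse. Division by a - 1 turns this into ln c on
  either side of 1; the error is thus independent of the order and survives limits.\<close>

lemma renyi_ord_dominated:
  assumes a: "0 < a" "a \<noteq> 1" and c: "1 \<le> c" and dom: "\<And>x. pmf Q' x \<le> c * pmf Q x"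
  shows "renyi_ord a P Q \<le> renyi_ord a P Q' + ennreal (ln c)"
proof (cases "renyi_finite a P Q'")
  case False
  then show ?thesis using a by (simp add: renyi_ord_eq)
next
  case True
  let ?S = "renyi_sum a P Q" and ?S' = "renyi_sum a P Q'"
  have S': "0 < ?S'" using True renyi_sum_pos by blast
  have "renyi_finite a P Q \<and> ln ?S / (a - 1) \<le> ln ?S' / (a - 1) + ln c"
  proof (cases "a < 1")
    case True
    have "?S' \<le> (\<Sum>x\<in>UNIV. pmf P x powr a * (c * pmf Q x) powr (1 - a))"
      unfolding renyi_sum_def using dom a True
      by (intro sum_mono mult_left_mono powr_mono2) auto
    also have "\<dots> = c powr (1 - a) * ?S"
      using c by (simp add: powr_mult renyi_sum_def sum_distrib_left algebra_simps)
    finally have le: "?S' \<le> c powr (1 - a) * ?S" .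
    then have S: "0 < ?S" using S' c
      by (metis less_le_trans powr_gt_zero zero_less_mult_pos order_less_le_trans zero_less_one less_irrefl order_le_less)
    have "ln ?S' \<le> ln (c powr (1 - a) * ?S)" using le S S' c by (subst ln_le_cancel_iff) auto
    also have "\<dots> = (1 - a) * ln c + ln ?S" using S c by (simp add: ln_mult ln_powr)
    finally have "(ln ?S + (1 - a) * ln c) / (a - 1) \<le> ln ?S' / (a - 1)"
      using True by (intro divide_right_mono_neg) auto
    moreover have "(1 - a) * ln c / (a - 1) = - ln c" using True by (simp add: divide_eq_eq algebra_simps)
    ultimately show ?thesis using S True by (simp add: renyi_finite_def add_divide_distrib)
  next
    case False
    then have a1: "1 < a" using a by simp
    have z: "pmf Q' x = 0 \<Longrightarrow> pmf P x = 0" for x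
      using True False by (auto simp: renyi_finite_def)
    have z': "pmf Q x = 0 \<Longrightarrow> pmf P x = 0" for x
      using z[of x] dom[of x] by (simp add: order_antisym)
    then have fin: "renyi_finite a P Q" using False by (simp add: renyi_finite_def)
    have "?S \<le> (\<Sum>x\<in>UNIV. pmf P x powr a * (c powr (a - 1) * pmf Q' x powr (1 - a)))"
      unfolding renyi_sum_def
    proof (intro sum_mono)
      fix x
      show "pmf P x powr a * pmf Q x powr (1 - a) \<le> pmf P x powr a * (c powr (a - 1) * pmf Q' x powr (1 - a))"
      proof (cases "pmf P x = 0")
        case False
        then have q: "0 < pmf Q' x" "0 < pmf Q x" using z z' by (auto simp: less_le)
        have "(c * pmf Q x) powr (1 - a) \<le> pmf Q' x powr (1 - a)"
          using q a1 dom by (intro powr_mono2') auto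
        then have "c powr (a - 1) * (c powr (1 - a) * pmf Q x powr (1 - a)) \<le> c powr (a - 1) * pmf Q' x powr (1 - a)"
          using q c by (intro mult_left_mono) (auto simp: powr_mult)
        moreover have "c powr (a - 1) * c powr (1 - a) = 1" using c by (simp flip: powr_add)
        ultimately have "pmf Q x powr (1 - a) \<le> c powr (a - 1) * pmf Q' x powr (1 - a)"
          by (simp add: mult.assoc[symmetric])
        then show ?thesis by (intro mult_left_mono) auto
      qed simp
    qed
    also have "\<dots> = c powr (a - 1) * ?S'"
      by (simp add: renyi_sum_def sum_distrib_left algebra_simps)
    finally have "ln ?S \<le> ln (c powr (a - 1) * ?S')"
      using renyi_sum_pos[OF fin] S' c by (subst ln_le_cancel_iff) auto
    also have "\<dots> = (a - 1) * ln c + ln ?S'" using S' c by (simp add: ln_mult ln_powr)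
    finally have "ln ?S / (a - 1) \<le> ((a - 1) * ln c + ln ?S') / (a - 1)"
      using a1 by (intro divide_right_mono) auto
    then show ?thesis using fin a1 by (simp add: add_divide_distrib)
  qed
  then show ?thesis
    using True a c ln_renyi_sum_nonneg[of a P Q']
    by (simp add: renyi_ord_eq ennreal_leI flip: ennreal_plus)
qed

section \<open>Dependence on the order, and a bound against the uniform distribution\<close>

text \<open>Hoelder interpolation between an order and order 1, where the sum is replaced by the
  total mass of \<open>P\<close>. Comparing orders on the same side of 1 is enough for the limits at
  0, 1 and infinity.\<close>

lemma renyi_ord_mono:
  assumes a: "0 < a" "a \<le> b" and ab: "b < 1 \<or> 1 < a"
  shows "renyi_ord a P Q \<le> renyi_ord b P Q"
proof (cases "renyi_finite b P Q \<and> a \<noteq> b")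
  case False
  then show ?thesis using assms by (auto simp: renyi_ord_eq)
next
  case True
  then have lt: "a < b" using a by simp
  have fin: "renyi_finite a P Q" using True ab lt
    by (auto simp: renyi_finite_def renyi_sum_pos_iff)
  have Sa: "0 < renyi_sum a P Q" and Sb: "0 < renyi_sum b P Q"
    using True fin renyi_sum_pos by blast+
  \<comment> \<open>The order v lies between u and 1, so each summand at v is a geometric mean of
    the summand at u and \<open>pmf P x\<close>.\<close>
  have step: "ln (renyi_sum v P Q) \<le> l * ln (renyi_sum u P Q)"
    if l: "0 < l" "l < 1" and v: "v = u * l + (1 - l)" and S: "0 < renyi_sum v P Q" "0 < renyi_sum u P Q" for u v l
  proof -
    have "renyi_sum v P Q = (\<Sum>x\<in>UNIV. (pmf P x powr u * pmf Q x powr (1 - u)) powr l * pmf P x powr (1 - l))"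
      unfolding renyi_sum_def
    proof (intro sum.cong refl)
      fix x
      have "1 - v = (1 - u) * l" by (simp add: v algebra_simps)
      then show "pmf P x powr v * pmf Q x powr (1 - v) =
          (pmf P x powr u * pmf Q x powr (1 - u)) powr l * pmf P x powr (1 - l)"
        by (simp add: powr_mult powr_powr v powr_add)
    qed
    also have "\<dots> \<le> renyi_sum u P Q powr l * (\<Sum>x\<in>UNIV. pmf P x) powr (1 - l)"
      unfolding renyi_sum_def using l by (intro holder_sum) auto
    also have "\<dots> = renyi_sum u P Q powr l" by (simp add: sum_pmf_eq_1)
    finally have "ln (renyi_sum v P Q) \<le> ln (renyi_sum u P Q powr l)"
      using S by (subst ln_le_cancel_iff) auto
    then show ?thesis using S by (simp add: ln_powr)
  qed
  have "ln (renyi_sum a P Q) / (a - 1) \<le> ln (renyi_sum b P Q) / (b - 1)"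
  proof (cases "b < 1")
    case True
    have "b = a * ((1 - b) / (1 - a)) + (1 - (1 - b) / (1 - a))"
      using True lt by (simp add: divide_simps) (simp add: algebra_simps)
    then have "ln (renyi_sum b P Q) \<le> (1 - b) / (1 - a) * ln (renyi_sum a P Q)"
      using True lt Sa Sb by (intro step) auto
    then show ?thesis using True lt by (simp add: field_simps)
  next
    case False
    \<comment> \<open>Above 1 the roles change: now a is the order between b and 1.\<close>
    have "a = b * ((a - 1) / (b - 1)) + (1 - (a - 1) / (b - 1))"
      using False ab lt by (simp add: divide_simps) (simp add: algebra_simps)
    then have "ln (renyi_sum a P Q) \<le> (a - 1) / (b - 1) * ln (renyi_sum b P Q)"
      using False ab lt Sa Sb by (intro step) auto
    then show ?thesis using False ab lt by (simp add: field_simps)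
  qed
  then show ?thesis using True fin assms by (auto simp: renyi_ord_eq ennreal_leI)
qed

text \<open>As probabilities are at most 1, the sum \<open>T\<close> of their powers is at least 1
  below order 1 and at most 1 above it, so ln T / (a - 1) is never positive. What remains is a bound
  free of \<open>P\<close> and of the order.\<close>

lemma renyi_ord_uniform_le:
  fixes P :: "'x::finite pmf"
  assumes a: "0 < a" "a \<noteq> 1"
  shows "renyi_ord a P (pmf_of_set UNIV) \<le> ennreal (ln (real CARD('x)))"
proof -
  let ?n = "real CARD('x)"
  have n: "1 \<le> ?n" using zero_less_card_finite[where 'a = 'x] by linarith
  have u: "pmf (pmf_of_set UNIV) x = 1 / ?n" for x :: 'x by simp
  define T where "T = (\<Sum>x\<in>UNIV. pmf P x powr a)"
  have sum1: "(\<Sum>x\<in>UNIV. pmf P x) = 1" by (simp add: sum_pmf_eq_1)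
  have S: "renyi_sum a P (pmf_of_set UNIV) = T * ?n powr (a - 1)"
    unfolding renyi_sum_def u T_def using n
    by (simp add: sum_distrib_right sum_divide_distrib powr_divide powr_diff)
  have fin: "renyi_finite a P (pmf_of_set UNIV)"
    unfolding renyi_finite_def renyi_sum_pos_iff u
    using n set_pmf_not_empty[of P] by (auto simp: pmf_positive_iff)
  have T: "0 < T" using renyi_sum_pos[OF fin] n unfolding S by (simp add: zero_less_mult_iff)
  have "ln T / (a - 1) \<le> 0"
  proof (cases "a < 1")
    case True
    have "1 \<le> T" unfolding T_def sum1[symmetric]
      using a True powr_mono'[of a 1 "pmf P _"] by (intro sum_mono) (auto simp: pmf_le_1)
    then show ?thesis using True by (simp add: divide_nonneg_neg)
  next
    case False
    have "T \<le> 1" unfolding T_def sum1[symmetric]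
      using a False powr_mono'[of 1 a "pmf P _"] by (intro sum_mono) (auto simp: pmf_le_1)
    then show ?thesis using False T by (simp add: divide_nonpos_nonneg)
  qed
  moreover have "ln (T * ?n powr (a - 1)) = ln T + (a - 1) * ln ?n"
    using T n by (simp add: ln_mult ln_powr)
  ultimately have "ln (renyi_sum a P (pmf_of_set UNIV)) / (a - 1) \<le> ln ?n"
    using a by (simp add: S add_divide_distrib)
  then show ?thesis using a fin by (simp add: renyi_ord_eq ennreal_leI)
qed

section \<open>All orders\<close>

text \<open>\<open>Lim\<close> in \<open>renyi_div\<close> is meaningful only if the limit exists.
  Monotonicity provides it, since \<open>ennreal\<close> is a complete order; the next two lemmas
  serve the other limit points.\<close>

lemma mono_tendsto_at_right:
  fixes f :: "real \<Rightarrow> ennreal"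
  assumes "a < b" and mono: "\<And>x y. a < x \<Longrightarrow> x \<le> y \<Longrightarrow> y < b \<Longrightarrow> f x \<le> f y"
  shows "(f \<longlongrightarrow> (INF x\<in>{a<..<b}. f x)) (at_right a)"
proof (rule decreasing_tendsto)
  show "\<forall>\<^sub>F x in at_right a. (INF x\<in>{a<..<b}. f x) \<le> f x"
    using eventually_at_right_real[OF \<open>a < b\<close>] by eventually_elim (auto intro: INF_lower)
next
  fix y assume "(INF x\<in>{a<..<b}. f x) < y"
  then obtain x where x: "a < x" "x < b" "f x < y" by (auto simp: INF_less_iff)
  show "\<forall>\<^sub>F x in at_right a. f x < y"
    using eventually_at_right_real[OF \<open>a < x\<close>]
    by eventually_elim (use x in \<open>auto intro!: le_less_trans[OF mono[of _ x]]\<close>)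
qed

lemma mono_tendsto_at_left:
  fixes f :: "real \<Rightarrow> ennreal"
  assumes "a < b" and mono: "\<And>x y. a < x \<Longrightarrow> x \<le> y \<Longrightarrow> y < b \<Longrightarrow> f x \<le> f y"
  shows "(f \<longlongrightarrow> (SUP x\<in>{a<..<b}. f x)) (at_left b)"
proof (rule increasing_tendsto)
  show "\<forall>\<^sub>F x in at_left b. f x \<le> (SUP x\<in>{a<..<b}. f x)"
    using eventually_at_left_real[OF \<open>a < b\<close>] by eventually_elim (auto intro: SUP_upper)
next
  fix y assume "y < (SUP x\<in>{a<..<b}. f x)"
  then obtain x where x: "a < x" "x < b" "y < f x" by (auto simp: less_SUP_iff)
  show "\<forall>\<^sub>F x in at_left b. y < f x"
    using eventually_at_left_real[OF \<open>x < b\<close>]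
    by eventually_elim (use x in \<open>auto intro!: less_le_trans[OF _ mono[of x]]\<close>)
qed

lemma mono_tendsto_at_top:
  fixes f :: "real \<Rightarrow> ennreal"
  assumes mono: "\<And>x y. a < x \<Longrightarrow> x \<le> y \<Longrightarrow> f x \<le> f y"
  shows "(f \<longlongrightarrow> (SUP x\<in>{a<..}. f x)) at_top"
proof (rule increasing_tendsto)
  show "\<forall>\<^sub>F x in at_top. f x \<le> (SUP x\<in>{a<..}. f x)"
    using eventually_gt_at_top[of a] by eventually_elim (auto intro: SUP_upper)
next
  fix y assume "y < (SUP x\<in>{a<..}. f x)"
  then obtain x where x: "a < x" "y < f x" by (auto simp: less_SUP_iff)
  show "\<forall>\<^sub>F x in at_top. y < f x"
    using eventually_gt_at_top[of x]
    by eventually_elim (use x in \<open>auto intro!: less_le_trans[OF _ mono[of x]]\<close>)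
qed

text \<open>One sequence of simple orders serves all \<open>P\<close> and \<open>Q\<close> at once.
  Hence inequalities between divergences of several pairs pass to the limit without distinguishing
  cases of \<alpha>.\<close>

lemma renyi_div_sequence:
  fixes \<alpha> :: ennreal
  obtains s :: "nat \<Rightarrow> real" where "\<And>n. 0 < s n" "\<And>n. s n \<noteq> 1"
    "\<And>P Q :: 'x::finite pmf. (\<lambda>n. renyi_ord (s n) P Q) \<longlonglongrightarrow> renyi_div \<alpha> P Q"
proof -
  have Lim_eq: "(\<lambda>n. renyi_ord (s n) P Q) \<longlonglongrightarrow> Lim F (\<lambda>a. renyi_ord a P Q)"
    if "((\<lambda>a. renyi_ord a P Q) \<longlongrightarrow> l) F" "F \<noteq> bot" "filterlim s F sequentially"
    for s and P Q :: "'x pmf" and l F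
    using filterlim_compose[OF that(1,3)] tendsto_Lim[OF that(2,1)] by simp
  consider "\<alpha> = 0" | "\<alpha> = 1" | "\<alpha> = \<infinity>" | "0 < \<alpha>" "\<alpha> \<noteq> 1" "\<alpha> < \<infinity>"
    by (metis less_top infinity_ennreal_def zero_less_iff_neq_zero)
  then show thesis
  proof cases
    case 1
    show thesis
    \<comment> \<open>The double successor keeps the order away from the excluded value 1.\<close>
    proof (rule that[of "\<lambda>n. inverse (real (Suc (Suc n)))"])
      fix P Q :: "'x pmf"
      have "((\<lambda>a. renyi_ord a P Q) \<longlongrightarrow> (INF a\<in>{0<..<1}. renyi_ord a P Q)) (at_right 0)"
        by (intro mono_tendsto_at_right renyi_ord_mono) auto
      moreover have "filterlim (\<lambda>n. inverse (real (Suc (Suc n)))) (at_right 0) sequentially"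
        using LIMSEQ_Suc[OF LIMSEQ_inverse_real_of_nat] by (simp add: filterlim_at)
      ultimately show "(\<lambda>n. renyi_ord (inverse (real (Suc (Suc n)))) P Q) \<longlonglongrightarrow> renyi_div \<alpha> P Q"
        using Lim_eq[of P Q _ "at_right 0"] by (simp add: 1 renyi_div_def Let_def flip: renyi_ord_def)
    qed auto
  next
    case 2
    show thesis
    \<comment> \<open>Here the double successor keeps the order positive.\<close>
    proof (rule that[of "\<lambda>n. 1 - inverse (real (Suc (Suc n)))"])
      fix P Q :: "'x pmf"
      have "((\<lambda>a. renyi_ord a P Q) \<longlongrightarrow> (SUP a\<in>{0<..<1}. renyi_ord a P Q)) (at_left 1)"
        by (intro mono_tendsto_at_left renyi_ord_mono) auto
      moreover have "filterlim (\<lambda>n. 1 - inverse (real (Suc (Suc n)))) (at_left 1) sequentially"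
        using LIMSEQ_Suc[OF LIMSEQ_inverse_real_of_nat_add_minus[of 1]]
        by (simp add: filterlim_at eventually_sequentially)
      ultimately show "(\<lambda>n. renyi_ord (1 - inverse (real (Suc (Suc n)))) P Q) \<longlonglongrightarrow> renyi_div \<alpha> P Q"
        using Lim_eq[of P Q _ "at_left 1"] by (simp add: 2 renyi_div_def Let_def flip: renyi_ord_def)
    qed (auto simp: field_simps)
  next
    case 3
    show thesis
    proof (rule that[of "\<lambda>n. real (n + 2)"])
      fix P Q :: "'x pmf"
      have "((\<lambda>a. renyi_ord a P Q) \<longlongrightarrow> (SUP a\<in>{1<..}. renyi_ord a P Q)) at_top"
        by (intro mono_tendsto_at_top renyi_ord_mono) auto
      moreover have "filterlim (\<lambda>n. real (n + 2)) at_top sequentially"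
        using filterlim_compose[OF filterlim_real_sequentially filterlim_add_const_nat_at_top] .
      ultimately show "(\<lambda>n. renyi_ord (real (n + 2)) P Q) \<longlonglongrightarrow> renyi_div \<alpha> P Q"
        using Lim_eq[of P Q _ "at_top"] by (simp add: 3 renyi_div_def Let_def flip: renyi_ord_def)
    qed auto
  next
    case 4
    obtain r where r: "\<alpha> = ennreal r" "0 < r" "r \<noteq> 1"
      using 4 by (cases \<alpha>) auto
    show thesis
      by (rule that[of "\<lambda>_. r"]) (use 4 r in \<open>auto simp: renyi_div_def renyi_ord_def\<close>)
  qed
qed

lemma renyi_div_convex:
  assumes t: "0 < t" "t < 1"
    and mix: "\<And>x. pmf Q x = (1 - t) * pmf Q0 x + t * pmf Q1 x"
  shows "renyi_div \<alpha> P Q \<le> ennreal (1 - t) * renyi_div \<alpha> P Q0 + ennreal t * renyi_div \<alpha> P Q1"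
proof -
  obtain s :: "nat \<Rightarrow> real" where s: "\<And>n. 0 < s n" "\<And>n. s n \<noteq> 1"
    and lim: "\<And>P Q :: 'a pmf. (\<lambda>n. renyi_ord (s n) P Q) \<longlonglongrightarrow> renyi_div \<alpha> P Q"
    by (rule renyi_div_sequence[where \<alpha> = \<alpha>]) blast
  have "(\<lambda>n. ennreal (1 - t) * renyi_ord (s n) P Q0 + ennreal t * renyi_ord (s n) P Q1)
     \<longlonglongrightarrow> ennreal (1 - t) * renyi_div \<alpha> P Q0 + ennreal t * renyi_div \<alpha> P Q1"
    by (intro tendsto_add ennreal_tendsto_cmult lim) auto
  then show ?thesis
    by (rule LIMSEQ_le[OF lim]) (use renyi_ord_convex[OF s t mix] in auto)
qed

lemma renyi_div_dominated:
  assumes "1 \<le> c" and "\<And>x. pmf Q' x \<le> c * pmf Q x"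
  shows "renyi_div \<alpha> P Q \<le> renyi_div \<alpha> P Q' + ennreal (ln c)"
proof -
  obtain s :: "nat \<Rightarrow> real" where s: "\<And>n. 0 < s n" "\<And>n. s n \<noteq> 1"
    and lim: "\<And>P Q :: 'a pmf. (\<lambda>n. renyi_ord (s n) P Q) \<longlonglongrightarrow> renyi_div \<alpha> P Q"
    by (rule renyi_div_sequence[where \<alpha> = \<alpha>]) blast
  have "(\<lambda>n. renyi_ord (s n) P Q' + ennreal (ln c)) \<longlonglongrightarrow> renyi_div \<alpha> P Q' + ennreal (ln c)"
    by (intro tendsto_add lim tendsto_const)
  then show ?thesis
    by (rule LIMSEQ_le[OF lim]) (use renyi_ord_dominated[OF s assms] in auto)
qed

lemma renyi_div_uniform_le:
  fixes P :: "'x::finite pmf"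
  shows "renyi_div \<alpha> P (pmf_of_set UNIV) \<le> ennreal (ln (real CARD('x)))"
proof -
  obtain s :: "nat \<Rightarrow> real" where s: "\<And>n. 0 < s n" "\<And>n. s n \<noteq> 1"
    and lim: "\<And>P Q :: 'x pmf. (\<lambda>n. renyi_ord (s n) P Q) \<longlonglongrightarrow> renyi_div \<alpha> P Q"
    by (rule renyi_div_sequence[where \<alpha> = \<alpha>]) blast
  show ?thesis
    by (rule LIMSEQ_le_const2[OF lim]) (use renyi_ord_uniform_le[OF s] in auto)
qed

text \<open>At a simple order only finitely many measurable functions
  \<open>pmf (P \<theta>) x\<close> are involved; the remaining orders are limits of sequences of
  such functions.\<close>

lemma borel_measurable_renyi_div:
  fixes P :: "'t \<Rightarrow> 'x::finite pmf"
  assumes P: "(\<lambda>\<theta>. measure_pmf (P \<theta>)) \<in> M \<rightarrow>\<^sub>M prob_algebra (count_space UNIV)"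
  shows "(\<lambda>\<theta>. renyi_div \<alpha> (P \<theta>) Q) \<in> borel_measurable M"
proof -
  obtain s :: "nat \<Rightarrow> real" where "\<And>n. 0 < s n" "\<And>n. s n \<noteq> 1"
    and lim: "\<And>P Q :: 'x pmf. (\<lambda>n. renyi_ord (s n) P Q) \<longlonglongrightarrow> renyi_div \<alpha> P Q"
    by (rule renyi_div_sequence[where \<alpha> = \<alpha>]) blast
  have [measurable]: "(\<lambda>\<theta>. pmf (P \<theta>) x) \<in> borel_measurable M" for x
    using measurable_compose[OF measurable_prob_algebraD[OF P] measurable_measure_subprob_algebra[of "{x}"]]
    by (simp add: pmf.rep_eq)
  have "(\<lambda>\<theta>. renyi_ord a (P \<theta>) Q) \<in> borel_measurable M" for a
    unfolding renyi_ord_def renyi_simple_def ln_ext_def renyi_term_def by measurable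
  then show ?thesis
    by (rule borel_measurable_LIMSEQ_order[OF lim])
qed

section \<open>A minimax theorem for finitely many convex functions\<close>

text \<open>The pairs lying strictly above some (f v - c, g v - c) form a convex set without the
  origin. A separating normal has nonnegative components because the set is closed upwards;
  normalised, they are the weights.\<close>

lemma two_function_minimax:
  fixes f g :: "'v::real_vector \<Rightarrow> real"
  assumes f: "convex_on C f" and g: "convex_on C g" and ne: "C \<noteq> {}"
    and ge: "\<And>v. v \<in> C \<Longrightarrow> c \<le> f v \<or> c \<le> g v"
  obtains l where "0 \<le> l" "l \<le> 1" "\<And>v. v \<in> C \<Longrightarrow> c \<le> (1 - l) * f v + l * g v"
proof -
  define K where "K = {k. \<exists>v\<in>C. f v - c < fst k \<and> g v - c < snd k}"
  have "convex K"
  proof (rule convexI)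
    fix x y and s t :: real
    assume "x \<in> K" "y \<in> K" and st: "0 \<le> s" "0 \<le> t" "s + t = 1"
    then obtain v w where v: "v \<in> C" "f v - c < fst x" "g v - c < snd x"
      and w: "w \<in> C" "f w - c < fst y" "g w - c < snd y"
      by (auto simp: K_def)
    have mix: "h (s *\<^sub>R v + t *\<^sub>R w) - c < s * p + t * q"
      if h: "convex_on C h" and "h v - c < p" "h w - c < q" for h p q
    proof -
      have "h (s *\<^sub>R v + t *\<^sub>R w) - c \<le> s * h v + t * h w - (s + t) * c"
        using h v(1) w(1) st unfolding convex_on_def by fastforce
      also have "\<dots> = s * (h v - c) + t * (h w - c)" by (simp add: algebra_simps)
      also have "\<dots> < s * p + t * q"
      \<comment> \<open>At least one of the weights is positive, which keeps the inequality
        strict.\<close>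
      proof (cases "s = 0")
        case True
        then show ?thesis using that st by simp
      next
        case False
        then show ?thesis using that st by (intro add_less_le_mono mult_strict_left_mono mult_left_mono) auto
      qed
      finally show ?thesis .
    qed
    have "s *\<^sub>R v + t *\<^sub>R w \<in> C"
      using convex_on_imp_convex[OF f] v(1) w(1) st by (auto simp: convex_def)
    then show "s *\<^sub>R x + t *\<^sub>R y \<in> K"
      unfolding K_def using mix[OF f v(2) w(2)] mix[OF g v(3) w(3)] by auto
  qed
  moreover have "0 \<notin> K" using ge by (force simp: K_def)
  ultimately obtain a where a: "a \<noteq> 0" "\<And>k. k \<in> K \<Longrightarrow> 0 \<le> inner a k"
    using separating_hyperplane_set_0[of K] by blast
  obtain p q where pq: "a = (p, q)" by (cases a)
  have K: "0 \<le> p * y + q * z" if "v \<in> C" "f v - c < y" "g v - c < z" for v y z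
    using a(2)[of "(y, z)"] that by (auto simp: K_def pq)
  obtain v where v: "v \<in> C" using ne by blast
  \<comment> \<open>An affine function that is nonnegative on a half-line has nonnegative slope. For
    negative r the point - (e + 1) / r already has the value -1, and larger points do no
    better.\<close>
  have unbounded: "0 \<le> r" if "\<And>y. d < y \<Longrightarrow> 0 \<le> r * y + e" for r d e :: real
  proof (rule ccontr)
    assume "\<not> 0 \<le> r"
    then have "r * max (d + 1) (- (e + 1) / r) + e \<le> r * (- (e + 1) / r) + e"
      by (intro add_right_mono mult_left_mono_neg) auto
    also have "\<dots> < 0" using \<open>\<not> 0 \<le> r\<close> by simp
    finally show False
      using that[of "max (d + 1) (- (e + 1) / r)"] by (simp add: less_max_iff_disj)
  qed
  have p: "0 \<le> p"
    using K[OF v _ less_add_one] by (rule unbounded)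
  have q: "0 \<le> q"
    using K[OF v less_add_one] by (intro unbounded[of _ q]) (subst add.commute)
  have pos: "0 < p + q" using a(1) p q by (auto simp: pq zero_prod_def less_le)
  \<comment> \<open>Membership in \<open>K\<close> is strict, so both coordinates are raised by e /
    (p + q). This costs e in total, and e is arbitrary.\<close>
  have *: "c * (p + q) \<le> p * f v + q * g v" if "v \<in> C" for v
  proof (rule field_le_epsilon)
    fix e :: real assume "0 < e"
    then have "0 \<le> p * (f v - c + e / (p + q)) + q * (g v - c + e / (p + q))"
      using pos by (intro K[OF that]) auto
    also have "\<dots> = p * f v + q * g v - c * (p + q) + (p + q) * (e / (p + q))"
      by (simp add: algebra_simps del: times_divide_eq_right)
    finally show "c * (p + q) \<le> p * f v + q * g v + e" using pos by simp
  qed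
  show thesis
  proof (rule that[of "q / (p + q)"])
    have "1 - q / (p + q) = p / (p + q)" using pos by (simp add: field_simps)
    then show "c \<le> (1 - q / (p + q)) * f v + q / (p + q) * g v" if "v \<in> C" for v
      using *[OF that] pos by (simp add: pos_le_divide_eq flip: add_divide_distrib)
  qed (use p q pos in auto)
qed

lemma convex_on_weighted_sum:
  fixes f :: "'i \<Rightarrow> 'v::real_vector \<Rightarrow> real"
  assumes "finite I" "convex C" "\<And>i. i \<in> I \<Longrightarrow> convex_on C (f i)" "\<And>i. i \<in> I \<Longrightarrow> 0 \<le> w i"
  shows "convex_on C (\<lambda>v. \<Sum>i\<in>I. w i * f i v)"
  using assms
proof (induction I rule: finite_induct)
  case empty
  then show ?case by (simp add: convex_on_def)
next
  case (insert i I)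
  then show ?case by (simp add: convex_on_add convex_on_cmul)
qed

text \<open>Induction on \<open>I\<close>: restrict to the sublevel set of the new function, and combine the weights
  obtained there with the new function by the case of two functions.\<close>

lemma finite_minimax:
  fixes f :: "'i \<Rightarrow> 'v::real_vector \<Rightarrow> real"
  assumes "finite I" "convex C" "C \<noteq> {}" "\<And>i. i \<in> I \<Longrightarrow> convex_on C (f i)"
    and "\<And>v. v \<in> C \<Longrightarrow> \<exists>i\<in>I. c \<le> f i v"
  shows "\<exists>w. (\<forall>i\<in>I. 0 \<le> w i) \<and> sum w I = 1 \<and> (\<forall>v\<in>C. c \<le> (\<Sum>i\<in>I. w i * f i v))"
  using assms
proof (induction I arbitrary: C rule: finite_induct)
  case empty
  then show ?case by auto
next
  case (insert j I)
  define C' where "C' = {v\<in>C. f j v < c}"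
  have fj: "convex_on C (f j)" using insert.prems by simp
  show ?case
  proof (cases "C' = {}")
    \<comment> \<open>The new function alone stays above c on all of \<open>C\<close> and gets the
      whole weight.\<close>
    case True
    then have "\<forall>v\<in>C. c \<le> f j v" by (force simp: C'_def)
    moreover have "(\<Sum>i\<in>I. (if i = j then 1 else 0) * h i) = 0" for h :: "'i \<Rightarrow> real"
      using insert.hyps by (intro sum.neutral) auto
    note this this[of "\<lambda>_. 1"]
    ultimately show ?thesis using insert.hyps
      by (intro exI[of _ "\<lambda>i. if i = j then 1 else 0"]) simp
  next
    case False
    have "convex C'"
    proof (rule convexI)
      fix x y and s t :: real
      assume xy: "x \<in> C'" "y \<in> C'" and st: "0 \<le> s" "0 \<le> t" "s + t = 1"
      have "f j (s *\<^sub>R x + t *\<^sub>R y) \<le> s * f j x + t * f j y"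
        using fj xy st by (auto simp: convex_on_def C'_def)
      also have "\<dots> < c" using xy st by (intro convex_bound_lt) (auto simp: C'_def)
      finally show "s *\<^sub>R x + t *\<^sub>R y \<in> C'"
        using xy st \<open>convex C\<close> by (auto simp: convex_def C'_def)
    qed
    moreover have "convex_on C' (f i)" if "i \<in> I" for i
      using insert.prems(3)[of i] that \<open>convex C'\<close>
      by (auto intro: convex_on_subset simp: C'_def)
    \<comment> \<open>On the sublevel set the index given by the hypothesis cannot be j.\<close>
    moreover have "\<exists>i\<in>I. c \<le> f i v" if "v \<in> C'" for v
      using insert.prems(4)[of v] that by (auto simp: C'_def)
    ultimately obtain w where w: "\<And>i. i \<in> I \<Longrightarrow> 0 \<le> w i" "sum w I = 1"
      "\<And>v. v \<in> C' \<Longrightarrow> c \<le> (\<Sum>i\<in>I. w i * f i v)"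
      using insert.IH[of C'] False by blast
    have "convex_on C (\<lambda>v. \<Sum>i\<in>I. w i * f i v)"
      using insert w by (intro convex_on_weighted_sum) auto
    moreover have "c \<le> (\<Sum>i\<in>I. w i * f i v) \<or> c \<le> f j v" if "v \<in> C" for v
      using w(3)[of v] that by (force simp: C'_def)
    ultimately obtain l where l: "0 \<le> l" "l \<le> 1"
      "\<And>v. v \<in> C \<Longrightarrow> c \<le> (1 - l) * (\<Sum>i\<in>I. w i * f i v) + l * f j v"
      using two_function_minimax[OF _ fj \<open>C \<noteq> {}\<close>, of "\<lambda>v. \<Sum>i\<in>I. w i * f i v" c] by blast
    define u where "u i = (if i = j then l else (1 - l) * w i)" for i
    have "(\<Sum>i\<in>I. u i * h i) = (1 - l) * (\<Sum>i\<in>I. w i * h i)" for h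
      unfolding sum_distrib_left using insert.hyps by (intro sum.cong) (auto simp: u_def)
    note u = this this[of "\<lambda>_. 1"]
    show ?thesis
      using insert.hyps l w u by (intro exI[of _ u]) (auto simp: u_def add.commute)
  qed
qed

section \<open>Redundancy and capacity\<close>

lemma pmf_embed_pmf_finite:
  fixes g :: "'a \<Rightarrow> real"
  assumes "finite I" "\<And>x. 0 \<le> g x" "\<And>x. x \<notin> I \<Longrightarrow> g x = 0" "sum g I = 1"
  shows "pmf (embed_pmf g) x = g x"
proof (rule pmf_embed_pmf)
  have "(\<integral>\<^sup>+ x. ennreal (g x) \<partial>count_space UNIV) = (\<Sum>x\<in>I. ennreal (g x))"
    using assms by (intro nn_integral_count_space') auto
  then show "(\<integral>\<^sup>+ x. ennreal (g x) \<partial>count_space UNIV) = 1"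
    using assms by (simp add: sum_ennreal)
qed (use assms in auto)

text \<open>All coordinates are nonnegative, so the l1 norm, which dominates the Euclidean one,
  equals 1.\<close>

lemma compact_shrunk_simplex:
  "compact {v :: real ^ 'n. (\<forall>i. \<delta> \<le> v $ i) \<and> (\<Sum>i\<in>UNIV. v $ i) = 1}" (is "compact ?C")
  if "0 \<le> \<delta>"
proof (rule compact_eq_bounded_closed[THEN iffD2], intro conjI)
  have "norm v \<le> 1" if "v \<in> ?C" for v
  proof -
    have "0 \<le> v $ i" for i using that \<open>0 \<le> \<delta>\<close> order_trans[of 0 \<delta> "v $ i"] by simp
    note nonneg = this
    have "norm v \<le> (\<Sum>i\<in>UNIV. \<bar>v $ i\<bar>)" by (rule norm_le_l1_cart)
    also have "\<dots> = (\<Sum>i\<in>UNIV. v $ i)"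
      using nonneg by simp
    finally show ?thesis using that by simp
  qed
  then show "bounded ?C" by (auto simp: bounded_iff)
  show "closed ?C"
    by (intro closed_Collect_conj closed_Collect_all closed_Collect_le closed_Collect_eq continuous_intros)
qed

lemma convex_shrunk_simplex:
  "convex {v :: real ^ 'n. (\<forall>i. \<delta> \<le> v $ i) \<and> (\<Sum>i\<in>UNIV. v $ i) = 1}"
proof (rule convexI)
  fix v w :: "real ^ 'n" and s t :: real
  assume "v \<in> {v. (\<forall>i. \<delta> \<le> v $ i) \<and> (\<Sum>i\<in>UNIV. v $ i) = 1}"
    "w \<in> {v. (\<forall>i. \<delta> \<le> v $ i) \<and> (\<Sum>i\<in>UNIV. v $ i) = 1}"
    and st: "0 \<le> s" "0 \<le> t" "s + t = 1"
  then have v: "\<And>i. \<delta> \<le> v $ i" "(\<Sum>i\<in>UNIV. v $ i) = 1"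
    and w: "\<And>i. \<delta> \<le> w $ i" "(\<Sum>i\<in>UNIV. w $ i) = 1" by auto
  have "\<delta> \<le> s * v $ i + t * w $ i" for i
  proof -
    have "\<delta> = s * \<delta> + t * \<delta>" using st by (simp flip: distrib_right)
    also have "\<dots> \<le> s * v $ i + t * w $ i"
      using v(1) w(1) st by (intro add_mono mult_left_mono) auto
    finally show ?thesis .
  qed
  then show "s *\<^sub>R v + t *\<^sub>R w \<in> {v. (\<forall>i. \<delta> \<le> v $ i) \<and> (\<Sum>i\<in>UNIV. v $ i) = 1}"
    using v(2) w(2) st by (simp add: sum.distrib flip: sum_distrib_left)
qed

lemma finite_input_distribution:
  fixes P :: "'t::topological_space \<Rightarrow> 'x::finite pmf"
  assumes P: "(\<lambda>\<theta>. measure_pmf (P \<theta>)) \<in> borel \<rightarrow>\<^sub>M prob_algebra (count_space UNIV)"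
    and I: "finite I" and w: "\<And>\<theta>. \<theta> \<in> I \<Longrightarrow> 0 \<le> w \<theta>" "sum w I = 1"
  obtains \<pi> where "\<pi> \<in> space (prob_algebra borel)"
    "\<And>Q. avg_renyi_div \<alpha> P \<pi> Q = (\<Sum>\<theta>\<in>I. ennreal (w \<theta>) * renyi_div \<alpha> (P \<theta>) Q)"
proof -
  define p where "p = embed_pmf (\<lambda>\<theta>. if \<theta> \<in> I then w \<theta> else 0)"
  have p: "pmf p \<theta> = (if \<theta> \<in> I then w \<theta> else 0)" for \<theta>
    unfolding p_def using I w by (intro pmf_embed_pmf_finite[of I]) auto
  \<comment> \<open>For \<open>measure_pmf\<close> every set is measurable; the image under the
    identity restricts it to the Borel sets.\<close>
  define \<pi> :: "'t measure" where "\<pi> = distr (measure_pmf p) borel (\<lambda>\<theta>. \<theta>)"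
  have "\<pi> \<in> space (prob_algebra borel)"
    unfolding \<pi>_def space_prob_algebra
    by (simp add: prob_space.prob_space_distr measure_pmf.prob_space_axioms)
  moreover have "avg_renyi_div \<alpha> P \<pi> Q = (\<Sum>\<theta>\<in>I. ennreal (w \<theta>) * renyi_div \<alpha> (P \<theta>) Q)" for Q
  proof -
    have "avg_renyi_div \<alpha> P \<pi> Q = (\<integral>\<^sup>+ \<theta>. renyi_div \<alpha> (P \<theta>) Q \<partial>measure_pmf p)"
      unfolding avg_renyi_div_def \<pi>_def
      using borel_measurable_renyi_div[OF P] by (subst nn_integral_distr) auto
    also have "\<dots> = (\<Sum>\<theta>\<in>I. renyi_div \<alpha> (P \<theta>) Q * ennreal (pmf p \<theta>))"
      using I by (intro nn_integral_measure_pmf_support) (auto simp: set_pmf_iff p)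
    also have "\<dots> = (\<Sum>\<theta>\<in>I. ennreal (w \<theta>) * renyi_div \<alpha> (P \<theta>) Q)"
      by (intro sum.cong) (auto simp: p mult.commute)
    finally show ?thesis .
  qed
  ultimately show thesis using that by blast
qed

text \<open>The divergences are finite on the simplex shrunk away from its boundary, so the minimax lemma
  for real-valued functions applies there; mixing with the uniform distribution transfers the bound
  to arbitrary \<open>Q\<close> at the cost of the term in \<open>t\<close>.\<close>

lemma near_optimal_input:
  fixes P :: "'t::topological_space \<Rightarrow> 'x::finite pmf"
  assumes P: "(\<lambda>\<theta>. measure_pmf (P \<theta>)) \<in> borel \<rightarrow>\<^sub>M prob_algebra (count_space UNIV)"
    and t: "0 < t" "t < 1" and c: "0 \<le> c" and e: "0 < e"
    and less: "ennreal (c + e) < minimax_redundancy \<alpha> P"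
  obtains \<pi> where "\<pi> \<in> space (prob_algebra borel)"
    "\<And>Q. ennreal c \<le> avg_renyi_div \<alpha> P \<pi> Q + ennreal (t * ln (real CARD('x)))"
proof -
  let ?n = "real CARD('x)"
  define L where "L = ln ?n"
  define d :: "'x pmf \<Rightarrow> 'x pmf \<Rightarrow> ennreal" where "d = renyi_div \<alpha>"
  define U :: "'x pmf" where "U = pmf_of_set UNIV"
  have n: "1 \<le> ?n" using zero_less_card_finite[where 'a = 'x] by linarith
  have L: "0 \<le> L" using n by (simp add: L_def)
  have U: "pmf U x = 1 / ?n" for x by (simp add: U_def)
  have dU: "d R U \<le> ennreal L" for R
    unfolding d_def U_def L_def by (rule renyi_div_uniform_le)
  \<comment> \<open>The mass that every point receives when the uniform distribution is mixed in
    with weight t.\<close>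
  define \<delta> where "\<delta> = t / ?n"
  have \<delta>: "0 < \<delta>" "\<delta> \<le> 1 / ?n" using t n by (auto simp: \<delta>_def divide_right_mono)
  define C where "C = {v :: real ^ 'x. (\<forall>i. \<delta> \<le> v $ i) \<and> (\<Sum>i\<in>UNIV. v $ i) = 1}"
  define q where "q v = embed_pmf (\<lambda>x. v $ x)" for v :: "real ^ 'x"
  have q: "pmf (q v) x = v $ x" if "v \<in> C" for v x
    unfolding q_def using that \<delta> by (intro pmf_embed_pmf_finite[of UNIV]) (auto simp: C_def intro: order_trans less_imp_le)
  have C: "compact C" "convex C"
    unfolding C_def using \<delta> by (auto intro!: compact_shrunk_simplex convex_shrunk_simplex)
  have "(\<chi> x. 1 / ?n) \<in> C" using \<delta> n by (simp add: C_def)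
  then have ne: "C \<noteq> {}" by blast
  \<comment> \<open>On \<open>C\<close> every coordinate is at least \<delta>, so 1 / \<delta> times
    \<open>q v\<close> dominates the uniform distribution, whose divergences are at most
    \<open>L\<close>.\<close>
  have finite_d: "d R (q v) < \<infinity>" if "v \<in> C" for R v
  proof -
    have "d R (q v) \<le> d R U + ennreal (ln (1 / \<delta>))"
      unfolding d_def
    proof (rule renyi_div_dominated)
      have "\<delta> \<le> 1" using \<delta> n by (meson divide_le_eq_1 order_trans zero_less_one less_le_trans)
      then show "1 \<le> 1 / \<delta>" using \<delta> by simp
      fix x
      have "pmf U x \<le> 1" by (rule pmf_le_1)
      also have "1 \<le> 1 / \<delta> * pmf (q v) x" using that \<delta> by (simp add: q C_def)
      finally show "pmf U x \<le> 1 / \<delta> * pmf (q v) x" .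
    qed
    also have "\<dots> < \<infinity>" using dU[of R] by (auto simp: less_top[symmetric] top_unique)
    finally show ?thesis .
  qed
  define f where "f \<theta> v = enn2real (d (P \<theta>) (q v))" for \<theta> v
  have f: "d (P \<theta>) (q v) = ennreal (f \<theta> v)" if "v \<in> C" for \<theta> v
    using finite_d[OF that] by (simp add: f_def ennreal_enn2real_if less_top[symmetric])
  have f0: "0 \<le> f \<theta> v" for \<theta> v by (simp add: f_def)
  have f_convex: "convex_on C (f \<theta>)" for \<theta>
  proof (rule convex_onI[OF _ C(2)])
    fix s :: real and v w :: "real ^ 'x"
    assume s: "0 < s" "s < 1" and vw: "v \<in> C" "w \<in> C"
    let ?u = "(1 - s) *\<^sub>R v + s *\<^sub>R w"
    have u: "?u \<in> C" using C(2) s vw by (simp add: convex_def)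
    have "ennreal (f \<theta> ?u) \<le> ennreal (1 - s) * d (P \<theta>) (q v) + ennreal s * d (P \<theta>) (q w)"
      unfolding f[OF u, symmetric] d_def using s by (rule renyi_div_convex) (simp add: q u vw)
    also have "\<dots> = ennreal ((1 - s) * f \<theta> v + s * f \<theta> w)"
      using s f0 by (simp add: f vw ennreal_plus ennreal_mult)
    finally show "f \<theta> ?u \<le> (1 - s) * f \<theta> v + s * f \<theta> w"
      using s f0 by (subst (asm) ennreal_le_iff) auto
  qed
  have "\<exists>\<theta>. ennreal (c + e) < d (P \<theta>) (q v)" for v
  proof -
    have "minimax_redundancy \<alpha> P \<le> (SUP \<theta>. d (P \<theta>) (q v))"
      unfolding minimax_redundancy_def d_def by (rule INF_lower) simp
    then show ?thesis using less by (auto simp: less_SUP_iff dest: less_le_trans)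
  qed
  then obtain \<theta> where \<theta>: "\<And>v. ennreal (c + e) < d (P (\<theta> v)) (q v)" by metis
  \<comment> \<open>Coordinates in \<open>C\<close> are at least \<delta>, so a move by less than
    \<delta> * e changes each by at most the fraction e of itself. By domination the divergence then
    changes by at most ln (1 + e), which the margin e above c absorbs.\<close>
  define \<eta> where "\<eta> = \<delta> * e"
  have \<eta>: "0 < \<eta>" using \<delta> e by (simp add: \<eta>_def)
  have near: "c \<le> f (\<theta> v) w" if v: "v \<in> C" and w: "w \<in> C" and dist: "w \<in> ball v \<eta>" for v w
  proof -
    have "d (P (\<theta> v)) (q v) \<le> d (P (\<theta> v)) (q w) + ennreal (ln (1 + e))"
      unfolding d_def
    proof (rule renyi_div_dominated)
      fix x
      have "\<bar>(v - w) $ x\<bar> \<le> \<eta>"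
        using component_le_norm_cart[of "v - w" x] dist by (simp add: dist_norm)
      moreover have "\<delta> * e \<le> v $ x * e" using v e by (intro mult_right_mono) (auto simp: C_def)
      ultimately show "pmf (q w) x \<le> (1 + e) * pmf (q v) x"
        using v w by (simp add: q \<eta>_def algebra_simps)
    qed (use e in simp)
    also have "\<dots> = ennreal (f (\<theta> v) w + ln (1 + e))"
      using w f0 e by (simp add: f ennreal_plus)
    finally have "ennreal (c + e) < ennreal (f (\<theta> v) w + ln (1 + e))"
      using \<theta>[of v] by (rule less_le_trans[rotated])
    then have "c + e < f (\<theta> v) w + ln (1 + e)"
      using c e by (simp add: ennreal_less_iff del: ennreal_plus)
    then show ?thesis using ln_add_one_self_le_self[of e] e by simp
  qed
  \<comment> \<open>A finite subcover leaves finitely many parameters, one of which is good at each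
    point of \<open>C\<close>.\<close>
  obtain V where V: "V \<subseteq> C" "finite V" "C \<subseteq> (\<Union>v\<in>V. ball v \<eta>)"
    using compactE_image[OF C(1), of C "\<lambda>v. ball v \<eta>"] \<eta> by force
  have "\<exists>w. (\<forall>i\<in>\<theta> ` V. 0 \<le> w i) \<and> sum w (\<theta> ` V) = 1 \<and> (\<forall>v\<in>C. c \<le> (\<Sum>i\<in>\<theta> ` V. w i * f i v))"
  proof (rule finite_minimax)
    show "\<exists>i\<in>\<theta> ` V. c \<le> f i v" if "v \<in> C" for v
      using V near that by blast
  qed (use V C ne f_convex in auto)
  then obtain w where w: "\<And>i. i \<in> \<theta> ` V \<Longrightarrow> 0 \<le> w i" "sum w (\<theta> ` V) = 1"
    "\<And>v. v \<in> C \<Longrightarrow> c \<le> (\<Sum>i\<in>\<theta> ` V. w i * f i v)" by blast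
  obtain \<pi> where \<pi>: "\<pi> \<in> space (prob_algebra borel)"
    "\<And>Q. avg_renyi_div \<alpha> P \<pi> Q = (\<Sum>i\<in>\<theta> ` V. ennreal (w i) * d (P i) Q)"
    unfolding d_def using finite_input_distribution[OF P, of "\<theta> ` V" w] w(1,2) V(2) by blast
  show thesis
  proof (rule that[OF \<pi>(1)])
    fix Q :: "'x pmf"
    define v :: "real ^ 'x" where "v = (\<chi> x. (1 - t) * pmf Q x + t * pmf U x)"
    have v: "v \<in> C"
      using t by (simp add: C_def v_def U \<delta>_def sum.distrib sum_pmf_eq_1 flip: sum_distrib_left)
    have "ennreal c \<le> ennreal (\<Sum>i\<in>\<theta> ` V. w i * f i v)" using w(3)[OF v] by (rule ennreal_leI)
    also have "\<dots> = (\<Sum>i\<in>\<theta> ` V. ennreal (w i) * d (P i) (q v))"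
      using w(1) f0 by (subst sum_ennreal[symmetric]) (auto simp: f[OF v] ennreal_mult)
    also have "\<dots> \<le> (\<Sum>i\<in>\<theta> ` V. ennreal (w i) * (d (P i) Q + ennreal (t * L)))"
    proof (intro sum_mono mult_left_mono)
      fix i
      have "d (P i) (q v) \<le> ennreal (1 - t) * d (P i) Q + ennreal t * d (P i) U"
        unfolding d_def using t by (rule renyi_div_convex) (simp add: q[OF v], simp add: v_def)
      also have "\<dots> \<le> 1 * d (P i) Q + ennreal t * ennreal L"
        using t by (intro add_mono mult_right_mono mult_left_mono dU) auto
      also have "\<dots> = d (P i) Q + ennreal (t * L)" using t L by (simp add: ennreal_mult)
      finally show "d (P i) (q v) \<le> d (P i) Q + ennreal (t * L)" .
    qed simp
    also have "\<dots> = avg_renyi_div \<alpha> P \<pi> Q + (\<Sum>i\<in>\<theta> ` V. ennreal (w i)) * ennreal (t * L)"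
      by (simp add: \<pi>(2) distrib_left sum.distrib sum_distrib_right)
    also have "(\<Sum>i\<in>\<theta> ` V. ennreal (w i)) = 1"
      using w(1,2) by (simp add: sum_ennreal)
    finally show "ennreal c \<le> avg_renyi_div \<alpha> P \<pi> Q + ennreal (t * ln ?n)"
      by (simp add: L_def)
  qed
qed

section \<open>The minimax inequality and its equality case\<close>

lemma redundancy_le_capacity:
  fixes P :: "'t::topological_space \<Rightarrow> 'x::finite pmf"
  assumes P: "(\<lambda>\<theta>. measure_pmf (P \<theta>)) \<in> borel \<rightarrow>\<^sub>M prob_algebra (count_space UNIV)"
  shows "minimax_redundancy \<alpha> P \<le> channel_capacity \<alpha> P"
proof (rule ccontr)
  assume "\<not> ?thesis"
  then have "channel_capacity \<alpha> P < minimax_redundancy \<alpha> P" by simp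
  then obtain b where b: "channel_capacity \<alpha> P < b" "b < minimax_redundancy \<alpha> P"
    using dense by blast
  \<comment> \<open>A second intermediate value supplies the positive margin c' - c that
    \<open>near_optimal_input\<close> requires.\<close>
  then obtain b' where b': "b < b'" "b' < minimax_redundancy \<alpha> P" using dense by blast
  obtain c where c: "b = ennreal c" "0 \<le> c" using b' by (cases b) auto
  obtain c' where c': "b' = ennreal c'" "0 \<le> c'" using b' by (cases b') auto
  have "c < c'" using b' c c' by (simp add: ennreal_less_iff)
  define L where "L = ln (real CARD('x))"
  have L: "0 \<le> L" using zero_less_card_finite[where 'a = 'x] by (simp add: L_def)
  have "ennreal c \<le> channel_capacity \<alpha> P"
  proof (rule ennreal_le_epsilon)
    fix e :: real assume e: "0 < e"
    \<comment> \<open>Makes the mixing error \<open>t * L\<close> at most e. The bound 1 / 2 keeps t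
      below 1, and L + 1 avoids division by zero when there is a single outcome.\<close>
    define t where "t = min (1 / 2) (e / (L + 1))"
    have t: "0 < t" "t < 1" using e L by (auto simp: t_def)
    have "t * L \<le> e / (L + 1) * (L + 1)" using e L by (intro mult_mono) (auto simp: t_def)
    then have tL: "t * L \<le> e" using L by simp
    obtain \<pi> where \<pi>: "\<pi> \<in> space (prob_algebra borel)"
      "\<And>Q. ennreal c \<le> avg_renyi_div \<alpha> P \<pi> Q + ennreal (t * L)"
      unfolding L_def
      using near_optimal_input[OF P t c(2), of "c' - c" \<alpha>] \<open>c < c'\<close> b' c' by auto
    \<comment> \<open>The error is subtracted first, so that the infimum over \<open>Q\<close> can
      be taken of the average alone.\<close>
    have "ennreal c - ennreal (t * L) \<le> (INF Q. avg_renyi_div \<alpha> P \<pi> Q)"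
      using \<pi>(2) by (intro INF_greatest) (simp add: ennreal_minus_le_iff add.commute)
    also have "\<dots> \<le> channel_capacity \<alpha> P"
      unfolding channel_capacity_def using \<pi>(1) by (rule SUP_upper)
    finally have "ennreal c \<le> channel_capacity \<alpha> P + ennreal (t * L)"
      by (simp add: ennreal_minus_le_iff add.commute)
    also have "\<dots> \<le> channel_capacity \<alpha> P + ennreal e" using tL by (intro add_left_mono ennreal_leI)
    finally show "ennreal c \<le> channel_capacity \<alpha> P + ennreal e" .
  qed
  then show False using b c by simp
qed

lemma minimax_redundancy_finite:
  fixes P :: "'t \<Rightarrow> 'x::finite pmf"
  shows "minimax_redundancy \<alpha> P < \<infinity>"
proof -
  have "minimax_redundancy \<alpha> P \<le> (SUP \<theta>. renyi_div \<alpha> (P \<theta>) (pmf_of_set UNIV))"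
    unfolding minimax_redundancy_def by (rule INF_lower) simp
  also have "\<dots> \<le> ennreal (ln (real CARD('x)))"
    by (intro SUP_least renyi_div_uniform_le)
  also have "\<dots> < \<infinity>" by simp
  finally show ?thesis .
qed

theorem theorem36:
  fixes P :: "'t::topological_space \<Rightarrow> 'x::finite pmf"
    and \<alpha> :: ennreal
    and Q_opt :: "'x pmf"
    and \<pi>_opt :: "'t measure"
  assumes closed_singletons: "\<And>\<theta>::'t. closed {\<theta>}"
    and measurable_P: "(\<lambda>\<theta>. measure_pmf (P \<theta>)) \<in> borel \<rightarrow>\<^sub>M prob_algebra (count_space UNIV)"
    and Q_opt: "redundancy_achieving \<alpha> P Q_opt"
    and \<pi>_opt: "capacity_achieving \<alpha> P \<pi>_opt"
  shows "(\<forall>Q. avg_renyi_div \<alpha> P \<pi>_opt Q_opt \<le> avg_renyi_div \<alpha> P \<pi>_opt Q) \<and>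
    (AE \<theta> in \<pi>_opt. renyi_div \<alpha> (P \<theta>) Q_opt = minimax_redundancy \<alpha> P)"
proof -
  define R where "R = minimax_redundancy \<alpha> P"
  have R: "R < \<infinity>" unfolding R_def by (rule minimax_redundancy_finite)
  have le: "renyi_div \<alpha> (P \<theta>) Q_opt \<le> R" for \<theta>
    using Q_opt unfolding redundancy_achieving_def R_def by (metis SUP_upper UNIV_I)
  interpret prob_space \<pi>_opt
    using \<pi>_opt by (simp add: capacity_achieving_def space_prob_algebra)
  have "sets \<pi>_opt = sets borel"
    using \<pi>_opt by (simp add: capacity_achieving_def space_prob_algebra)
  then have [measurable]: "(\<lambda>\<theta>. renyi_div \<alpha> (P \<theta>) Q_opt) \<in> borel_measurable \<pi>_opt"
    using borel_measurable_renyi_div[OF measurable_P, of \<alpha> Q_opt]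
    by (simp cong: measurable_cong_sets)
  have upper: "avg_renyi_div \<alpha> P \<pi>_opt Q_opt \<le> R"
  proof -
    have "avg_renyi_div \<alpha> P \<pi>_opt Q_opt \<le> (\<integral>\<^sup>+ \<theta>. R \<partial>\<pi>_opt)"
      unfolding avg_renyi_div_def using le by (intro nn_integral_mono)
    then show ?thesis by (simp add: emeasure_space_1)
  qed
  \<comment> \<open>Together with \<open>upper\<close> this gives minimality of \<open>Q_opt\<close>
    at once, and it forces the average at \<open>Q_opt\<close> to be \<open>R\<close>.\<close>
  have lower: "R \<le> avg_renyi_div \<alpha> P \<pi>_opt Q" for Q
  proof -
    have "R \<le> channel_capacity \<alpha> P"
      unfolding R_def using measurable_P by (rule redundancy_le_capacity)
    also have "\<dots> = (INF Q. avg_renyi_div \<alpha> P \<pi>_opt Q)"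
      using \<pi>_opt by (simp add: capacity_achieving_def)
    also have "\<dots> \<le> avg_renyi_div \<alpha> P \<pi>_opt Q" by (rule INF_lower) simp
    finally show ?thesis .
  qed
  \<comment> \<open>The gap to \<open>R\<close> is nonnegative with integral 0, hence vanishes
    almost everywhere. Finiteness of \<open>R\<close> is essential: in \<open>ennreal\<close>,
    infinity minus itself is infinity.\<close>
  have "(\<integral>\<^sup>+ \<theta>. R - renyi_div \<alpha> (P \<theta>) Q_opt \<partial>\<pi>_opt) = R - avg_renyi_div \<alpha> P \<pi>_opt Q_opt"
    unfolding avg_renyi_div_def
    using le upper R by (subst nn_integral_diff) (auto simp: emeasure_space_1 avg_renyi_div_def top_unique less_top)
  also have "\<dots> = 0" using lower[of Q_opt] R by (simp add: diff_eq_0_iff_ennreal less_top)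
  finally have "AE \<theta> in \<pi>_opt. R - renyi_div \<alpha> (P \<theta>) Q_opt = 0"
    by (subst (asm) nn_integral_0_iff_AE) auto
  then have "AE \<theta> in \<pi>_opt. renyi_div \<alpha> (P \<theta>) Q_opt = R"
    by eventually_elim (use le R in \<open>auto simp: diff_eq_0_iff_ennreal intro!: order_antisym\<close>)
  then show ?thesis using order_trans[OF upper lower] by (simp add: R_def)
qed

end
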